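(* Let $(\mathfrak{n},Q)$ be a uniform metric Lie algebra with uniform basis $\mathcal{B}=\{v_i\}_{i=1}^q\cup\{z_j\}_{j=1}^p$, let $\mathfrak{z}$ be the center of $\mathfrak{n}$ and $\mathfrak{v}$ its orthogonal complement, and let $G=(V,E)$ be the corresponding uniformly colored directed graph with coloring function $c:E\to\{z_j\}_{j=1}^p$. Let $V'\subseteq V=\{v_i\}_{i=1}^q$ and $S'\subseteq\{z_j\}_{j=1}^p$ be subsets with $V'\cup S'\neq\emptyset$, and let $\mathfrak{m}$ be the subspace of $\mathfrak{n}$ spanned by $V'\cup S'$. (1) The subspace $\mathfrak{m}$ is a subalgebra of $\mathfrak{n}$ if and only if whenever $v_i,v_j\in V'$ and $(v_i,v_j)\in E$, the color $c(v_i,v_j)$ is in $S'$. (2) Suppose $S'\neq\emptyset$. Then $\mathfrak{m}$ is invariant under $J_z$ for all $z\in\mathfrak{m}\cap\mathfrak{z}$ (meaning $J_z(\mathfrak{m}\cap\mathfrak{v})\subseteq\mathfrak{m}$ for all such $z$) if and only if for all $z_k\in S'$, every edge with color $z_k$ has neither or both of its vertices in $V'$.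
   Context: All Lie algebras are finite-dimensional over $\mathbb{R}$. Let $p,q,r$ be positive integers. A nilpotent Lie algebra $\mathfrak{n}$ is uniform of type $(p,q,r)$ if there exist a basis $\mathcal{B}=\{v_i\}_{i=1}^q\cup\{z_j\}_{j=1}^p$ of $\mathfrak{n}$ (a uniform basis) and a positive integer $s$ (the degree) such that: (i) for all $i,j\in\{1,\dots,q\}$ and $l,m\in\{1,\dots,p\}$, $[v_i,z_l]=0$, $[z_l,z_m]=0$ and $[v_i,v_j]\in\{0,\pm z_1,\dots,\pm z_p\}$; (ii) if $[v_i,v_j]$ is nonzero and $[v_i,v_j]=\pm[v_i,v_k]$, then $v_j=v_k$; (iii) for every $l$ there are exactly $r$ pairs $\{v_i,v_j\}$ (necessarily disjoint) with $[v_i,v_j]=z_l$ for one of the two orderings of the pair; (iv) for every $j$ there are exactly $s$ basis vectors $v_i$ with $[v_i,v_j]\neq 0$. A uniform metric Lie algebra $(\mathfrak{n},Q)$ is such an $\mathfrak{n}$ with the inner product $Q$ making $\mathcal{B}$ orthonormal. For $z\in\mathfrak{z}$, $J_z\in\operatorname{End}(\mathfrak{v})$ is defined by $Q(J_zv,w)=Q([v,w],z)$ for $v,w\in\mathfrak{v}$. The corresponding directed colored graph has vertex set $V=\{v_i\}_{i=1}^q$, edge set $E=\{(v_i,v_j): [v_i,v_j]=z_k\text{ for some }k\}$, and the edge $(v_i,v_j)$ has color $c(v_i,v_j)=z_k$ when $[v_i,v_j]=z_k$. *)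

theory Defs
  imports "HOL-Analysis.Analysis"
begin

text \<open>
  A finite-dimensional real metric Lie algebra is a bracket on a type of class
  \<^class>\<open>euclidean_space\<close>, the inner product Q being the one of the type class.
\<close>

definition lie_algebra :: "('a::real_vector \<Rightarrow> 'a \<Rightarrow> 'a) \<Rightarrow> bool" where
  "lie_algebra br \<longleftrightarrow> bilinear br \<and> (\<forall>x. br x x = 0) \<and>
     (\<forall>x y w. br x (br y w) + br y (br w x) + br w (br x y) = 0)"

primrec lower_central :: "('a::real_vector \<Rightarrow> 'a \<Rightarrow> 'a) \<Rightarrow> nat \<Rightarrow> 'a set" where
  "lower_central br 0 = UNIV"
| "lower_central br (Suc n) = span {br x y | x y. y \<in> lower_central br n}"

definition nilpotent_lie_algebra :: "('a::real_vector \<Rightarrow> 'a \<Rightarrow> 'a) \<Rightarrow> bool" where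
  "nilpotent_lie_algebra br \<longleftrightarrow> lie_algebra br \<and> (\<exists>n. lower_central br n = {0})"

definition lie_center :: "('a::real_vector \<Rightarrow> 'a \<Rightarrow> 'a) \<Rightarrow> 'a set" where
  "lie_center br = {x. \<forall>y. br x y = 0}"

definition lie_subalgebra :: "('a::real_vector \<Rightarrow> 'a \<Rightarrow> 'a) \<Rightarrow> 'a set \<Rightarrow> bool" where
  "lie_subalgebra br M \<longleftrightarrow> subspace M \<and> (\<forall>x\<in>M. \<forall>y\<in>M. br x y \<in> M)"

definition uniform_basis ::
  "nat \<Rightarrow> nat \<Rightarrow> nat \<Rightarrow> nat \<Rightarrow> ('a::real_vector \<Rightarrow> 'a \<Rightarrow> 'a) \<Rightarrow> (nat \<Rightarrow> 'a) \<Rightarrow> (nat \<Rightarrow> 'a) \<Rightarrow> bool"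
where
  "uniform_basis p q r s br v z \<longleftrightarrow>
     inj_on v {1..q} \<and> inj_on z {1..p} \<and> v ` {1..q} \<inter> z ` {1..p} = {} \<and>
     independent (v ` {1..q} \<union> z ` {1..p}) \<and> span (v ` {1..q} \<union> z ` {1..p}) = UNIV \<and>
     (\<forall>i\<in>{1..q}. \<forall>l\<in>{1..p}. br (v i) (z l) = 0) \<and>
     (\<forall>l\<in>{1..p}. \<forall>m\<in>{1..p}. br (z l) (z m) = 0) \<and>
     (\<forall>i\<in>{1..q}. \<forall>j\<in>{1..q}. br (v i) (v j) \<in> {0} \<union> z ` {1..p} \<union> uminus ` z ` {1..p}) \<and>
     (\<forall>i\<in>{1..q}. \<forall>j\<in>{1..q}. \<forall>k\<in>{1..q}.
        br (v i) (v j) \<noteq> 0 \<longrightarrow>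
        br (v i) (v j) = br (v i) (v k) \<or> br (v i) (v j) = - br (v i) (v k) \<longrightarrow> v j = v k) \<and>
     (\<forall>l\<in>{1..p}. card {{v i, v j} | i j. i \<in> {1..q} \<and> j \<in> {1..q} \<and> br (v i) (v j) = z l} = r) \<and>
     (\<forall>j\<in>{1..q}. card {v i | i. i \<in> {1..q} \<and> br (v i) (v j) \<noteq> 0} = s)"

definition uniform_metric_lie_algebra ::
  "nat \<Rightarrow> nat \<Rightarrow> nat \<Rightarrow> ('a::euclidean_space \<Rightarrow> 'a \<Rightarrow> 'a) \<Rightarrow> (nat \<Rightarrow> 'a) \<Rightarrow> (nat \<Rightarrow> 'a) \<Rightarrow> bool"
where
  "uniform_metric_lie_algebra p q r br v z \<longleftrightarrow>
     p > 0 \<and> q > 0 \<and> r > 0 \<and> nilpotent_lie_algebra br \<and>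
     (\<exists>s>0. uniform_basis p q r s br v z) \<and>
     pairwise orthogonal (v ` {1..q} \<union> z ` {1..p}) \<and>
     (\<forall>b \<in> v ` {1..q} \<union> z ` {1..p}. norm b = 1)"

text \<open>
  The skew map on the orthogonal complement of the center; only arguments \<open>w\<close> in the
  center and \<open>x\<close> in its complement are meaningful.  Existence and uniqueness of the
  value are shown in \<open>J_map_ex1\<close>.
\<close>

definition J_map :: "('a::euclidean_space \<Rightarrow> 'a \<Rightarrow> 'a) \<Rightarrow> 'a \<Rightarrow> 'a \<Rightarrow> 'a" where
  "J_map br w x = (THE u. u \<in> orthogonal_comp (lie_center br) \<and>
     (\<forall>y \<in> orthogonal_comp (lie_center br). u \<bullet> y = br x y \<bullet> w))"

lemma J_map_ex1:
  fixes br :: "'a::euclidean_space \<Rightarrow> 'a \<Rightarrow> 'a"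
  assumes "lie_algebra br"
  shows "\<exists>!u. u \<in> orthogonal_comp (lie_center br) \<and>
     (\<forall>y \<in> orthogonal_comp (lie_center br). u \<bullet> y = br x y \<bullet> w)"
proof -
  let ?W = "orthogonal_comp (lie_center br)"
  have lin: "linear (br x)"
    using assms by (simp add: lie_algebra_def bilinear_def)
  obtain a b where a: "a \<in> span ?W" and b: "\<And>y. y \<in> span ?W \<Longrightarrow> orthogonal b y"
    and ab: "adjoint (br x) w = a + b"
    using orthogonal_subspace_decomp_exists by blast
  have sp: "span ?W = ?W" by (simp add: span_eq_iff subspace_orthogonal_comp)
  have aW: "a \<bullet> y = br x y \<bullet> w" if "y \<in> ?W" for y
  proof -
    have "br x y \<bullet> w = y \<bullet> (a + b)" using adjoint_works[OF lin, of y w] ab by simp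
    moreover have "b \<bullet> y = 0" using b[of y] that sp by (simp add: orthogonal_def)
    ultimately show ?thesis by (simp add: inner_add_right inner_commute)
  qed
  show ?thesis
  proof (rule ex1I[of _ a])
    show "a \<in> ?W \<and> (\<forall>y\<in>?W. a \<bullet> y = br x y \<bullet> w)" using a sp aW by simp
    fix u assume u: "u \<in> ?W \<and> (\<forall>y\<in>?W. u \<bullet> y = br x y \<bullet> w)"
    then have "u - a \<in> ?W" using a sp subspace_orthogonal_comp subspace_diff by metis
    then have "(u - a) \<bullet> (u - a) = 0" using u aW by (simp add: inner_diff_left)
    then show "u = a" by simp
  qed
qed

definition edges ::
  "nat \<Rightarrow> nat \<Rightarrow> ('a \<Rightarrow> 'a \<Rightarrow> 'a) \<Rightarrow> (nat \<Rightarrow> 'a) \<Rightarrow> (nat \<Rightarrow> 'a) \<Rightarrow> ('a \<times> 'a) set"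
where
  "edges p q br v z =
     {(v i, v j) | i j. i \<in> {1..q} \<and> j \<in> {1..q} \<and> (\<exists>k\<in>{1..p}. br (v i) (v j) = z k)}"

text \<open>On an edge, the color \<open>z k\<close> with \<open>br (v i) (v j) = z k\<close> is the bracket itself.\<close>

definition edge_color :: "('a \<Rightarrow> 'a \<Rightarrow> 'a) \<Rightarrow> 'a \<times> 'a \<Rightarrow> 'a" where
  "edge_color br e = br (fst e) (snd e)"

end

theory Submission
  imports Defs
begin

text \<open>
  Each \<open>v j\<close> has a partner \<open>v i\<close> whose bracket with it is \<open>\<plusminus>z k\<close>, and by condition (ii) no other
  \<open>v j'\<close> has the same bracket with \<open>v i\<close> up to sign; pairing with \<open>v i\<close> therefore shows that a
  central element has no \<open>v j\<close>-component, so the center is the span of the \<open>z k\<close> and its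
  complement is the span of the \<open>v i\<close>. The span of a subset of an orthonormal basis is cut out by
  the vanishing of the remaining coordinates, so both claims reduce to statements about the
  brackets of basis vectors.
\<close>

section \<open>Linear algebra: spans, orthogonal bases and bilinear maps\<close>

text \<open>For the converse direction, split \<open>x = y + w\<close> with \<open>y\<close> in
  \<open>span T\<close> and \<open>w\<close> orthogonal to it. The vanishing coordinates make
  \<open>w\<close> orthogonal to the rest of \<open>B\<close> as well, hence to itself, so
  \<open>w = 0\<close>.\<close>

lemma span_subset_orthogonal_basis_iff:
  fixes B :: "'a::euclidean_space set"
  assumes orth: "pairwise orthogonal B" and sp: "span B = UNIV" and T: "T \<subseteq> B"
  shows "x \<in> span T \<longleftrightarrow> (\<forall>b\<in>B - T. x \<bullet> b = 0)"
proof
  have out: "y \<bullet> b = 0" if "y \<in> span T" "b \<in> B - T" for y b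
  proof -
    have "orthogonal b t" if "t \<in> T" for t
      using that \<open>b \<in> B - T\<close> T orth by (metis DiffE pairwiseD subsetD)
    then show ?thesis
      using orthogonal_to_span[OF that(1)] by (metis inner_commute orthogonal_def)
  qed
  then show "x \<in> span T \<Longrightarrow> \<forall>b\<in>B - T. x \<bullet> b = 0" by blast
  assume x: "\<forall>b\<in>B - T. x \<bullet> b = 0"
  obtain y w where y: "y \<in> span T" and w: "\<And>u. u \<in> span T \<Longrightarrow> orthogonal w u" and xyw: "x = y + w"
    using orthogonal_subspace_decomp_exists by blast
  have "orthogonal w b" if "b \<in> B" for b
  proof (cases "b \<in> T")
    case True
    then show ?thesis using w span_base by blast
  next
    case False
    then have "(y + w) \<bullet> b = 0" "y \<bullet> b = 0" using x out y that xyw by auto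
    then show ?thesis by (simp add: orthogonal_def inner_add_left)
  qed
  then have "orthogonal w w"
    by (intro orthogonal_to_span[of w B]) (auto simp: sp)
  then show "x \<in> span T" using xyw y by (simp add: orthogonal_def)
qed

text \<open>Two span inductions, one per argument, since preimages of subspaces under linear maps
  are subspaces. With \<open>W = {0}\<close> this extends vanishing from generators to
  spans.\<close>

lemma bilinear_span_subspace:
  assumes "bilinear f" "subspace W" "x \<in> span A" "y \<in> span B"
    and base: "\<And>a b. a \<in> A \<Longrightarrow> b \<in> B \<Longrightarrow> f a b \<in> W"
  shows "f x y \<in> W"
proof -
  have "linear (\<lambda>u. f u w)" "linear (f u)" for u w
    using assms(1) by (auto simp: bilinear_def)
  then have subL: "subspace {u. f u w \<in> W}" and subR: "subspace {w. f u w \<in> W}" for u w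
    using linear_subspace_vimage[OF _ \<open>subspace W\<close>] by (fastforce simp: vimage_def)+
  have "f a y \<in> W" if "a \<in> A" for a
    using \<open>y \<in> span B\<close> subR[of a] base[OF that] by (rule span_induct)
  then show ?thesis
    using \<open>x \<in> span A\<close> subL[of y] by (intro span_induct[of x A "\<lambda>u. f u y \<in> W"])
qed

lemma lie_algebra_skew:
  assumes "lie_algebra br"
  shows "br x y = - br y x"
proof -
  have bil: "bilinear br" and alt: "\<And>u. br u u = 0"
    using assms by (auto simp: lie_algebra_def)
  have "br x y + br y x = 0"
    using alt[of "x + y"] unfolding bilinear_ladd[OF bil] bilinear_radd[OF bil] by (simp add: alt add.commute)
  then show ?thesis
    by (rule eq_neg_iff_add_eq_0[THEN iffD2])
qed

section \<open>Uniform metric Lie algebras in terms of basis sets\<close>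

text \<open>The basis enters as two sets, so that the arguments run without indices.
  \<open>partner\<close> is the form in which the positive degree is used.\<close>

locale uniform_metric =
  fixes br :: "'a::euclidean_space \<Rightarrow> 'a \<Rightarrow> 'a"
    and V Z :: "'a set"
  assumes lie: "lie_algebra br"
    and orth: "pairwise orthogonal (V \<union> Z)"
    and unit: "b \<in> V \<union> Z \<Longrightarrow> norm b = 1"
    and span_basis: "span (V \<union> Z) = UNIV"
    and disj: "V \<inter> Z = {}"
    and br_VZ: "\<lbrakk>a \<in> V; c \<in> Z\<rbrakk> \<Longrightarrow> br a c = 0"
    and br_ZZ: "\<lbrakk>c \<in> Z; d \<in> Z\<rbrakk> \<Longrightarrow> br c d = 0"
    and br_VV: "\<lbrakk>a \<in> V; b \<in> V\<rbrakk> \<Longrightarrow> br a b = 0 \<or> br a b \<in> Z \<or> - br a b \<in> Z"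
    and br_inj: "\<lbrakk>a \<in> V; b \<in> V; b' \<in> V; br a b \<noteq> 0; br a b = br a b' \<or> br a b = - br a b'\<rbrakk>
          \<Longrightarrow> b = b'"
    and partner: "b \<in> V \<Longrightarrow> \<exists>a\<in>V. br a b \<noteq> 0"
begin

lemma bil: "bilinear br"
  using lie by (simp add: lie_algebra_def)

lemma inner_basis: "\<lbrakk>b \<in> V \<union> Z; c \<in> V \<union> Z\<rbrakk> \<Longrightarrow> b \<bullet> c = (if b = c then 1 else 0)"
  using orth unit[of b] by (auto simp: pairwise_def orthogonal_def norm_eq_1)

lemma in_span_iff: "T \<subseteq> V \<union> Z \<Longrightarrow> x \<in> span T \<longleftrightarrow> (\<forall>b\<in>(V \<union> Z) - T. x \<bullet> b = 0)"
  by (rule span_subset_orthogonal_basis_iff[OF orth span_basis])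

lemma in_span_V_iff: "x \<in> span V \<longleftrightarrow> (\<forall>c\<in>Z. x \<bullet> c = 0)"
  using in_span_iff[of V x] disj by blast

lemma in_span_Z_iff: "x \<in> span Z \<longleftrightarrow> (\<forall>b\<in>V. x \<bullet> b = 0)"
  using in_span_iff[of Z x] disj by blast

lemma basis_in_span_iff: "\<lbrakk>T \<subseteq> V \<union> Z; b \<in> V \<union> Z\<rbrakk> \<Longrightarrow> b \<in> span T \<longleftrightarrow> b \<in> T"
  using in_span_iff[of T b] inner_basis[of b b] span_base[of b T] by force

text \<open>Up to sign, nonzero brackets are elements of the orthonormal set \<open>Z\<close>;
  \<open>br_inj\<close> makes the two elements distinct.\<close>

lemma br_V_orthogonal:
  assumes "a \<in> V" "b \<in> V" "b' \<in> V" "b \<noteq> b'"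
  shows "br a b \<bullet> br a b' = 0"
proof (cases "br a b = 0 \<or> br a b' = 0")
  case False
  \<comment> \<open>\<open>c\<close> and \<open>c'\<close> are the brackets with the sign chosen so
    that they lie in \<open>Z\<close>.\<close>
  define c where "c = (if br a b \<in> Z then br a b else - br a b)"
  define c' where "c' = (if br a b' \<in> Z then br a b' else - br a b')"
  have "c \<in> Z" "c' \<in> Z"
    using br_VV[OF assms(1,2)] br_VV[OF assms(1,3)] False by (auto simp: c_def c'_def)
  moreover have "c \<noteq> c'"
    using br_inj[of a b b'] assms False minus_equation_iff[of "br a b" "br a b'"]
    by (auto simp: c_def c'_def split: if_splits)
  ultimately have "c \<bullet> c' = 0" using inner_basis[of c c'] by simp
  then show ?thesis by (auto simp: c_def c'_def split: if_splits)
qed auto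

lemma lie_center_eq: "lie_center br = span Z"
proof (intro equalityI subsetI)
  fix x assume x: "x \<in> lie_center br"
  have "x \<bullet> b = 0" if "b \<in> V" for b
  proof -
    obtain a where a: "a \<in> V" "br a b \<noteq> 0" using partner[OF \<open>b \<in> V\<close>] by blast
    \<comment> \<open>Bracketing with the partner \<open>a\<close> and projecting to
      \<open>br a b\<close> reads off the \<open>b\<close>-coordinate of \<open>u\<close>, up to a
      nonzero factor. For central \<open>u\<close> the left side is 0.\<close>
    have key: "br a u \<bullet> br a b = (u \<bullet> b) * (br a b \<bullet> br a b)" for u
    proof -
      have "u \<in> span (V \<union> Z)" by (simp add: span_basis)
      then show ?thesis
      proof (induction rule: span_induct)
        \<comment> \<open>In this induction \<open>base\<close> is the closure under linear
          combinations and \<open>step\<close> treats the basis vectors.\<close>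
        case base
        show ?case
          by (auto simp: subspace_def bilinear_rzero[OF bil] bilinear_radd[OF bil]
              bilinear_rmul[OF bil] algebra_simps)
      next
        case (step u)
        then consider "u = b" | "u \<in> V" "u \<noteq> b" | "u \<in> Z" "u \<noteq> b"
          using disj that by blast
        then show ?case
        proof cases
          case 1
          then show ?thesis using inner_basis[of b b] that by simp
        next
          case 2
          then show ?thesis using br_V_orthogonal[of a u b] a that inner_basis[of u b] by simp
        next
          case 3
          then show ?thesis using br_VZ[of a u] a that inner_basis[of u b] by simp
        qed
      qed
    qed
    have "br a x = 0"
      using x lie_algebra_skew[OF lie, of a x] by (simp add: lie_center_def)
    then show ?thesis using key[of x] a(2) by simp
  qed
  then show "x \<in> span Z" by (simp add: in_span_Z_iff)
next
  fix x assume x: "x \<in> span Z"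
  have "br x y = 0" for y
  proof -
    have "br c u = 0" if "c \<in> Z" "u \<in> V \<union> Z" for c u
      using that br_ZZ br_VZ lie_algebra_skew[OF lie, of c u] by auto
    then have "br x y \<in> {0}"
      by (intro bilinear_span_subspace[OF bil subspace_single_0 x, of y "V \<union> Z"]) (auto simp: span_basis)
    then show ?thesis by simp
  qed
  then show "x \<in> lie_center br" by (simp add: lie_center_def)
qed

lemma orthogonal_comp_center_eq: "orthogonal_comp (lie_center br) = span V"
proof (intro equalityI subsetI)
  fix x assume "x \<in> orthogonal_comp (lie_center br)"
  then show "x \<in> span V"
    unfolding in_span_V_iff lie_center_eq orthogonal_comp_def orthogonal_def
    by (auto simp: inner_commute span_base)
next
  fix x assume "x \<in> span V"
  then have "orthogonal x c" if "c \<in> Z" for c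
    using that by (simp add: in_span_V_iff orthogonal_def)
  then have "orthogonal x y" if "y \<in> span Z" for y
    using orthogonal_to_span[OF that] by blast
  then show "x \<in> orthogonal_comp (lie_center br)"
    by (auto simp: orthogonal_comp_def lie_center_eq orthogonal_commute)
qed

text \<open>Unique existence turns the definite description into its defining properties, with the
  complement of the center rewritten as \<open>span V\<close>.\<close>

lemma J_map_in_span: "J_map br w x \<in> span V"
  and J_map_inner: "y \<in> span V \<Longrightarrow> J_map br w x \<bullet> y = br x y \<bullet> w"
  using theI'[OF J_map_ex1[OF lie, of x w]]
  unfolding J_map_def orthogonal_comp_center_eq by blast+

section \<open>Subalgebras spanned by basis vectors\<close>

text \<open>Bilinearity reduces closure to brackets of generators, and a basis vector lies in the
  span of part of the basis only if it belongs to that part.\<close>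

lemma subalgebra_iff:
  assumes V': "V' \<subseteq> V" and S': "S' \<subseteq> Z"
  shows "lie_subalgebra br (span (V' \<union> S')) \<longleftrightarrow>
    (\<forall>a\<in>V'. \<forall>b\<in>V'. br a b \<in> Z \<longrightarrow> br a b \<in> S')"
proof
  have sub: "V' \<union> S' \<subseteq> V \<union> Z" using V' S' by auto
  assume alg: "lie_subalgebra br (span (V' \<union> S'))"
  show "\<forall>a\<in>V'. \<forall>b\<in>V'. br a b \<in> Z \<longrightarrow> br a b \<in> S'"
  proof (intro ballI impI)
    fix a b assume ab: "a \<in> V'" "b \<in> V'" "br a b \<in> Z"
    then have "br a b \<in> span (V' \<union> S')"
      using alg by (auto simp: lie_subalgebra_def span_base)
    then have "br a b \<in> V' \<union> S'" using basis_in_span_iff[OF sub] ab by blast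
    then show "br a b \<in> S'" using ab V' disj by blast
  qed
next
  assume closed: "\<forall>a\<in>V'. \<forall>b\<in>V'. br a b \<in> Z \<longrightarrow> br a b \<in> S'"
  have "br a b \<in> span (V' \<union> S')" if ab: "a \<in> V' \<union> S'" "b \<in> V' \<union> S'" for a b
  proof (cases "a \<in> V' \<and> b \<in> V'")
    case True
    have skew: "br b a = - br a b" by (rule lie_algebra_skew[OF lie])
    \<comment> \<open>In the last case the edge runs from \<open>b\<close> to \<open>a\<close>, so
      \<open>closed\<close> is applied to the reversed pair.\<close>
    consider "br a b = 0" | "br a b \<in> Z" | "br b a \<in> Z"
      using br_VV[of a b] True V' skew by auto
    then show ?thesis
    proof cases
      case 3
      then have "br b a \<in> span (V' \<union> S')" using closed True by (simp add: span_base)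
      then show ?thesis using skew span_neg by fastforce
    qed (use closed True in \<open>auto intro: span_base span_zero\<close>)
  next
    case False
    then consider "a \<in> V" "b \<in> Z" | "a \<in> Z" "b \<in> V" | "a \<in> Z" "b \<in> Z"
      using ab V' S' by blast
    then have "br a b = 0"
      using br_ZZ br_VZ lie_algebra_skew[OF lie, of a b] by cases auto
    then show ?thesis by (simp add: span_zero)
  qed
  then have "br x y \<in> span (V' \<union> S')" if "x \<in> span (V' \<union> S')" "y \<in> span (V' \<union> S')" for x y
    using bilinear_span_subspace[OF bil subspace_span that] by blast
  then show "lie_subalgebra br (span (V' \<union> S'))"
    unfolding lie_subalgebra_def by simp
qed

section \<open>Invariance under the maps \<open>J_map br w\<close>\<close>

text \<open>Each span is given by a set of vanishing coordinates, and intersecting spans unites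
  these sets.\<close>

lemma span_Int_center_and_comp:
  assumes V': "V' \<subseteq> V" and S': "S' \<subseteq> Z"
  shows "span (V' \<union> S') \<inter> lie_center br = span S'"
    and "span (V' \<union> S') \<inter> orthogonal_comp (lie_center br) = span V'"
proof -
  have sub: "V' \<union> S' \<subseteq> V \<union> Z" "S' \<subseteq> V \<union> Z" "V' \<subseteq> V \<union> Z" using V' S' by auto
  show "span (V' \<union> S') \<inter> lie_center br = span S'"
    unfolding set_eq_iff Int_iff lie_center_eq in_span_Z_iff in_span_iff[OF sub(1)]
      in_span_iff[OF sub(2)]
    using V' S' disj by blast
  show "span (V' \<union> S') \<inter> orthogonal_comp (lie_center br) = span V'"
    unfolding set_eq_iff Int_iff orthogonal_comp_center_eq in_span_V_iff in_span_iff[OF sub(1)]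
      in_span_iff[OF sub(3)]
    using V' S' disj by blast
qed

text \<open>For basis vectors, the coordinate of \<open>J_map br c a\<close> along \<open>b\<close>
  is \<open>br a b \<bullet> c\<close>, which is nonzero exactly when \<open>c\<close> colors an
  edge between \<open>a\<close> and \<open>b\<close>. Invariance thus says that no edge with color
  in \<open>S'\<close> leaves \<open>V'\<close>.\<close>

lemma J_map_invariant_iff:
  assumes V': "V' \<subseteq> V" and S': "S' \<subseteq> Z"
  shows "(\<forall>w\<in>span S'. J_map br w ` span V' \<subseteq> span (V' \<union> S')) \<longleftrightarrow>
    (\<forall>a\<in>V. \<forall>b\<in>V. br a b \<in> S' \<longrightarrow> (a \<in> V' \<longleftrightarrow> b \<in> V'))"
proof
  have sub: "V' \<union> S' \<subseteq> V \<union> Z" using V' S' by auto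
  assume inv: "\<forall>w\<in>span S'. J_map br w ` span V' \<subseteq> span (V' \<union> S')"
  \<comment> \<open>Only a nonzero inner product is asked for, so the sign from reversing an edge is
    harmless and both directions of the equivalence follow by exchanging \<open>a\<close> and
    \<open>b\<close>.\<close>
  have reach: "b \<in> V'" if "a \<in> V'" "b \<in> V" "c \<in> S'" "br a b \<bullet> c \<noteq> 0" for a b c
  proof -
    have "J_map br c a \<in> span (V' \<union> S')" using inv that span_base by blast
    moreover have "J_map br c a \<bullet> b \<noteq> 0" using J_map_inner[of b c a] that by (simp add: span_base)
    ultimately have "b \<in> V' \<union> S'" using in_span_iff[OF sub] that by blast
    then show ?thesis using that S' disj by blast
  qed
  show "\<forall>a\<in>V. \<forall>b\<in>V. br a b \<in> S' \<longrightarrow> (a \<in> V' \<longleftrightarrow> b \<in> V')"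
  proof (intro ballI impI)
    fix a b assume ab: "a \<in> V" "b \<in> V" "br a b \<in> S'"
    have "br a b \<bullet> br a b = 1" using inner_basis[of "br a b" "br a b"] ab S' by auto
    moreover have "br b a = - br a b" by (rule lie_algebra_skew[OF lie])
    ultimately show "a \<in> V' \<longleftrightarrow> b \<in> V'"
      using reach[of a b "br a b"] reach[of b a "br a b"] ab by auto
  qed
next
  have sub: "V' \<union> S' \<subseteq> V \<union> Z" using V' S' by auto
  assume edge: "\<forall>a\<in>V. \<forall>b\<in>V. br a b \<in> S' \<longrightarrow> (a \<in> V' \<longleftrightarrow> b \<in> V')"
  \<comment> \<open>A nonzero value would make \<open>c\<close> the color of an edge, in one of the
    two directions, with just one end in \<open>V'\<close>.\<close>
  have base: "br a b \<bullet> c = 0" if abc: "a \<in> V'" "b \<in> V - V'" "c \<in> S'" for a b c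
  proof (rule ccontr)
    assume nz: "br a b \<bullet> c \<noteq> 0"
    have skew: "br b a = - br a b" by (rule lie_algebra_skew[OF lie])
    consider "br a b \<in> Z" | "br b a \<in> Z"
      using br_VV[of a b] subsetD[OF V' abc(1)] abc(2) nz skew by auto
    then have "br a b = c \<or> br b a = c"
      using inner_basis[of "br a b" c] inner_basis[of "br b a" c] nz skew that S'
      by cases (auto split: if_splits)
    then show False using edge that V' by blast
  qed
  show "\<forall>w\<in>span S'. J_map br w ` span V' \<subseteq> span (V' \<union> S')"
  proof (intro ballI image_subsetI)
    fix w x assume w: "w \<in> span S'" and x: "x \<in> span V'"
    have "J_map br w x \<bullet> b = 0" if b: "b \<in> (V \<union> Z) - (V' \<union> S')" for b
    proof (cases "b \<in> Z")
      case True
      then show ?thesis using J_map_in_span in_span_V_iff by blast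
    next
      case False
      then have bV: "b \<in> V - V'" using b by blast
      \<comment> \<open>With \<open>b\<close> fixed, the coordinate is a bilinear form in
        \<open>x\<close> and \<open>w\<close>, so the vanishing in \<open>base\<close> passes from
        \<open>V'\<close> and \<open>S'\<close> to their spans.\<close>
      have "bilinear (\<lambda>x w. br x b \<bullet> w)"
        by (auto simp: bilinear_def linear_iff bilinear_ladd[OF bil] bilinear_lmul[OF bil]
            inner_add_left inner_add_right)
      then have "br x b \<bullet> w \<in> {0}"
        by (rule bilinear_span_subspace[OF _ subspace_single_0 x w]) (use base bV in auto)
      then show ?thesis using J_map_inner[of b w x] bV by (simp add: span_base)
    qed
    then show "J_map br w x \<in> span (V' \<union> S')" using in_span_iff[OF sub] by blast
  qed
qed

end

section \<open>Passage from the indexed basis to the locale, and the conclusion\<close>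

lemma uniform_metric_of_uniform_metric_lie_algebra:
  assumes "uniform_metric_lie_algebra p q r br v z"
  shows "uniform_metric br (v ` {1..q}) (z ` {1..p})"
proof -
  obtain s where "s > 0" and ub: "uniform_basis p q r s br v z"
    and lie: "lie_algebra br"
    and orth: "pairwise orthogonal (v ` {1..q} \<union> z ` {1..p})"
    and unit: "\<forall>b \<in> v ` {1..q} \<union> z ` {1..p}. norm b = 1"
    using assms unfolding uniform_metric_lie_algebra_def nilpotent_lie_algebra_def by blast
  have disj: "v ` {1..q} \<inter> z ` {1..p} = {}"
    and span_basis: "span (v ` {1..q} \<union> z ` {1..p}) = UNIV"
    and br_VZ: "\<forall>i\<in>{1..q}. \<forall>l\<in>{1..p}. br (v i) (z l) = 0"
    and br_ZZ: "\<forall>l\<in>{1..p}. \<forall>m\<in>{1..p}. br (z l) (z m) = 0"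
    and br_VV: "\<forall>i\<in>{1..q}. \<forall>j\<in>{1..q}.
      br (v i) (v j) \<in> {0} \<union> z ` {1..p} \<union> uminus ` z ` {1..p}"
    and br_inj: "\<forall>i\<in>{1..q}. \<forall>j\<in>{1..q}. \<forall>k\<in>{1..q}. br (v i) (v j) \<noteq> 0 \<longrightarrow>
      br (v i) (v j) = br (v i) (v k) \<or> br (v i) (v j) = - br (v i) (v k) \<longrightarrow> v j = v k"
    and partner: "\<forall>j\<in>{1..q}. card {v i | i. i \<in> {1..q} \<and> br (v i) (v j) \<noteq> 0} = s"
    using ub unfolding uniform_basis_def by blast+
  show ?thesis
  proof
    fix b assume "b \<in> v ` {1..q}"
    then obtain j where "j \<in> {1..q}" and "b = v j" by blast
    \<comment> \<open>The set of neighbors of \<open>b\<close> has \<open>s > 0\<close> elements, so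
      it contains a partner.\<close>
    have "card {v i | i. i \<in> {1..q} \<and> br (v i) b \<noteq> 0} > 0"
      using bspec[OF partner \<open>j \<in> {1..q}\<close>] \<open>s > 0\<close> unfolding \<open>b = v j\<close> by (simp only:)
    then have "{v i | i. i \<in> {1..q} \<and> br (v i) b \<noteq> 0} \<noteq> {}"
      by (simp only: card_gt_0_iff not_False_eq_True)
    then show "\<exists>a\<in>v ` {1..q}. br a b \<noteq> 0" by blast
  next
    fix a b assume "a \<in> v ` {1..q}" "b \<in> v ` {1..q}"
    then have "br a b \<in> {0} \<union> z ` {1..p} \<union> uminus ` z ` {1..p}"
      using br_VV by blast
    then show "br a b = 0 \<or> br a b \<in> z ` {1..p} \<or> - br a b \<in> z ` {1..p}"
      by force
  next
    fix a b b' assume "a \<in> v ` {1..q}" "b \<in> v ` {1..q}" "b' \<in> v ` {1..q}" "br a b \<noteq> 0"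
      "br a b = br a b' \<or> br a b = - br a b'"
    then show "b = b'" using br_inj by blast
  next
    show "br a c = 0" if "a \<in> v ` {1..q}" "c \<in> z ` {1..p}" for a c
      using br_VZ that by blast
    show "br c d = 0" if "c \<in> z ` {1..p}" "d \<in> z ` {1..p}" for c d
      using br_ZZ that by blast
    show "norm b = 1" if "b \<in> v ` {1..q} \<union> z ` {1..p}" for b
      using unit that by blast
  qed (fact lie orth span_basis disj)+
qed

theorem proposition4p14:
  fixes br :: "'a::euclidean_space \<Rightarrow> 'a \<Rightarrow> 'a"
    and p q r :: nat
    and v z :: "nat \<Rightarrow> 'a"
    and V' S' M :: "'a set"
  assumes "uniform_metric_lie_algebra p q r br v z"
    and "V' \<subseteq> v ` {1..q}"
    and "S' \<subseteq> z ` {1..p}"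
    and "V' \<union> S' \<noteq> {}"
    and "M = span (V' \<union> S')"
  shows "(lie_subalgebra br M \<longleftrightarrow>
            (\<forall>a\<in>V'. \<forall>b\<in>V'. (a, b) \<in> edges p q br v z \<longrightarrow> edge_color br (a, b) \<in> S')) \<and>
         (S' \<noteq> {} \<longrightarrow>
            ((\<forall>w \<in> M \<inter> lie_center br.
                J_map br w ` (M \<inter> orthogonal_comp (lie_center br)) \<subseteq> M) \<longleftrightarrow>
             (\<forall>c\<in>S'. \<forall>(a, b) \<in> edges p q br v z.
                edge_color br (a, b) = c \<longrightarrow>
                (a \<notin> V' \<and> b \<notin> V') \<or> (a \<in> V' \<and> b \<in> V'))))"
proof -
  interpret uniform_metric br "v ` {1..q}" "z ` {1..p}"
    by (rule uniform_metric_of_uniform_metric_lie_algebra[OF assms(1)])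
  have edges: "(a, b) \<in> edges p q br v z \<longleftrightarrow>
    a \<in> v ` {1..q} \<and> b \<in> v ` {1..q} \<and> br a b \<in> z ` {1..p}" for a b
  proof
    assume "(a, b) \<in> edges p q br v z"
    then show "a \<in> v ` {1..q} \<and> b \<in> v ` {1..q} \<and> br a b \<in> z ` {1..p}"
      by (auto simp: edges_def)
  next
    assume "a \<in> v ` {1..q} \<and> b \<in> v ` {1..q} \<and> br a b \<in> z ` {1..p}"
    then obtain i j k where "i \<in> {1..q}" "j \<in> {1..q}" "k \<in> {1..p}"
      "a = v i" "b = v j" "br a b = z k" by blast
    then show "(a, b) \<in> edges p q br v z"
      unfolding edges_def by blast
  qed
  have "lie_subalgebra br M \<longleftrightarrow>
    (\<forall>a\<in>V'. \<forall>b\<in>V'. (a, b) \<in> edges p q br v z \<longrightarrow> edge_color br (a, b) \<in> S')"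
    unfolding assms(5) subalgebra_iff[OF assms(2,3)] edges edge_color_def fst_conv snd_conv
    using subsetD[OF assms(2)] by metis
  moreover have "(\<forall>w \<in> M \<inter> lie_center br.
        J_map br w ` (M \<inter> orthogonal_comp (lie_center br)) \<subseteq> M) \<longleftrightarrow>
      (\<forall>c\<in>S'. \<forall>(a, b) \<in> edges p q br v z. edge_color br (a, b) = c \<longrightarrow>
        (a \<notin> V' \<and> b \<notin> V') \<or> (a \<in> V' \<and> b \<in> V'))"
    unfolding assms(5) span_Int_center_and_comp[OF assms(2,3)] J_map_invariant_iff[OF assms(2,3)]
    \<comment> \<open>Elements of \<open>S'\<close> are among the \<open>z k\<close>, so a bracket
      of two vertices that lies in \<open>S'\<close> already comes from an edge.\<close>
    unfolding Ball_def split_paired_All prod.case edges edge_color_def fst_conv snd_conv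
    using subsetD[OF assms(3)] by metis
  ultimately show ?thesis by blast
qed

end
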